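(* For every $\theta\in\mathbb T^{N}$, where $N=|X\setminus A|$, the Lipschitz seminorm of the character $\chi_\theta:(K(X,A),\rho)\to(S^1,\operatorname{dist})$ equals the Lipschitz seminorm of the phase function $\phi_\theta:(X/A,\overline d_1)\to(S^1,\operatorname{dist})$: $$\mathrm{Lip}(\chi_\theta)=\mathrm{Lip}(\phi_\theta).$$
   Context: Lipschitz seminorm: for a map $f:(M,\rho_M)\to(N',\rho_{N'})$ of metric spaces, $\mathrm{Lip}(f):=\sup_{\alpha\ne\beta}\rho_{N'}(f(\alpha),f(\beta))/\rho_M(\alpha,\beta)\in[0,\infty]$. Setting: $(X,d)$ is a metric space and $A\subseteq X$ is nonempty with $X\setminus A=\{x_1,\dots,x_N\}$ finite, $N\ge1$. Write $d(x,A)=\inf_{a\in A}d(x,a)$ and $d_1(x,y):=\min\{d(x,y),\,d(x,A)+d(y,A)\}$. Let $X/A=\{[A],x_1,\dots,x_N\}$ be the quotient collapsing $A$ to the basepoint $[A]$, and let $\overline d_1$ be the function on $X/A$ induced by $d_1$; it is assumed to be a metric on $X/A$ (equivalently $d(x_j,A)>0$ for all $j$). Diagrams: $D(X,A)$ is the free commutative monoid on $X\setminus A$ (finite multisets of points of $X\setminus A$; the point $[A]$ is identified with $0$). For $\alpha,\beta\in D(X,A)$, $W_1(\alpha,\beta)$ is the infimum of $\sum_{i}\overline d_1(u_i,v_i)$ over all finite multisets $\{(u_i,v_i)\}_i$ of pairs in $(X/A)\times(X/A)$ such that $\sum_i u_i$ equals $\alpha$ and $\sum_i v_i$ equals $\beta$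 modulo multiples of $[A]$. $K(X,A)$ is the Grothendieck group of $D(X,A)$, identified with the free abelian group $\mathbb Z^{N}$ with basis $e_1,\dots,e_N$, where $e_j$ is the class of $x_j$. It carries the translation-invariant metric $\rho(a-b,c-e):=W_1(a+e,c+b)$ for $a,b,c,e\in D(X,A)$. Characters and phases: $\mathbb T^{N}=\mathbb R^{N}/2\pi\mathbb Z^{N}$. For $\theta\in\mathbb T^N$, $\chi_\theta:K(X,A)\to S^1\subset\mathbb C$ is $\chi_\theta(\sum_j n_je_j)=\exp(i\sum_j n_j\theta_j)$. The phase function $\phi_\theta:X/A\to S^1$ is $\phi_\theta([A])=1$, $\phi_\theta(x_j)=e^{i\theta_j}$. $S^1$ carries the geodesic (shorter arc length) metric $\operatorname{dist}$, i.e. $\operatorname{dist}(e^{ia},e^{ib})=\inf_{k\in\mathbb Z}|a-b+2\pi k|$. *)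

theory Defs
  imports
    "HOL-Analysis.Analysis"
    "HOL-Library.Multiset"
    "HOL-Algebra.Free_Abelian_Groups"
begin

text \<open>The metrics \<open>dM\<close>, \<open>dN\<close> are explicit because none of the spaces involved carries
  its metric as a type-class instance. Only the domain set \<open>M\<close> enters the supremum. If \<open>dM\<close> is a
  metric on \<open>M\<close>, then every denominator below is positive.\<close>

definition Lip ::
  "'a set \<Rightarrow> ('a \<Rightarrow> 'a \<Rightarrow> real) \<Rightarrow> ('b \<Rightarrow> 'b \<Rightarrow> real) \<Rightarrow> ('a \<Rightarrow> 'b) \<Rightarrow> ennreal"
  where "Lip M dM dN f =
    (SUP (\<alpha>, \<beta>) \<in> {(\<alpha>, \<beta>). \<alpha> \<in> M \<and> \<beta> \<in> M \<and> \<alpha> \<noteq> \<beta>}.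
       ennreal (dN (f \<alpha>) (f \<beta>)) / ennreal (dM \<alpha> \<beta>))"


subsection \<open>The quotient of a metric space by a subset\<close>

definition dist_to :: "('a \<Rightarrow> 'a \<Rightarrow> real) \<Rightarrow> 'a set \<Rightarrow> 'a \<Rightarrow> real"
  where "dist_to d A x = (INF a\<in>A. d x a)"

definition d1 :: "('a \<Rightarrow> 'a \<Rightarrow> real) \<Rightarrow> 'a set \<Rightarrow> 'a \<Rightarrow> 'a \<Rightarrow> real"
  where "d1 d A x y = min (d x y) (dist_to d A x + dist_to d A y)"

text \<open>In \<open>X/A\<close> the value \<^term>\<open>None\<close> is the basepoint \<open>[A]\<close>, and \<^term>\<open>Some x\<close> is the class of
  the point \<open>x\<close> outside \<open>A\<close>.\<close>

definition quot :: "'a set \<Rightarrow> 'a set \<Rightarrow> 'a option set"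
  where "quot X A = insert None (Some ` (X - A))"

definition quot_proj :: "'a set \<Rightarrow> 'a \<Rightarrow> 'a option"
  where "quot_proj A x = (if x \<in> A then None else Some x)"

definition quot_rep :: "'a set \<Rightarrow> 'a option \<Rightarrow> 'a"
  where "quot_rep A u = (case u of None \<Rightarrow> (SOME a. a \<in> A) | Some x \<Rightarrow> x)"

text \<open>The function induced by \<^const>\<open>d1\<close>; it does not depend on the chosen representatives,
  see \<open>quot_d1_proj\<close> below.\<close>

definition quot_d1 :: "('a \<Rightarrow> 'a \<Rightarrow> real) \<Rightarrow> 'a set \<Rightarrow> 'a option \<Rightarrow> 'a option \<Rightarrow> real"
  where "quot_d1 d A u v = d1 d A (quot_rep A u) (quot_rep A v)"

lemma dist_to_nonneg:
  assumes "Metric_space X d" "A \<noteq> {}"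
  shows "0 \<le> dist_to d A x"
  unfolding dist_to_def by (rule cINF_greatest) (simp_all add: assms(2) Metric_space.nonneg[OF assms(1)])

lemma dist_to_le:
  assumes "Metric_space X d" "a \<in> A"
  shows "dist_to d A x \<le> d x a"
  unfolding dist_to_def
  by (rule cINF_lower)
    (auto simp: assms(2) Metric_space.nonneg[OF assms(1)] intro!: bdd_belowI[of _ 0])

lemma dist_to_mem:
  assumes "Metric_space X d" "A \<subseteq> X" "a \<in> A"
  shows "dist_to d A a = 0"
proof -
  have "d a a = 0" using assms Metric_space.zero[OF assms(1), of a a] by blast
  moreover have "0 \<le> dist_to d A a" using assms by (intro dist_to_nonneg) auto
  ultimately show ?thesis using dist_to_le[OF assms(1,3), of a] by linarith
qed

lemma quot_d1_proj:
  assumes "Metric_space X d" "A \<subseteq> X" "A \<noteq> {}" "x \<in> X" "y \<in> X"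
  shows "quot_d1 d A (quot_proj A x) (quot_proj A y) = d1 d A x y"
proof -
  define a0 where "a0 = (SOME a. a \<in> A)"
  have a0: "a0 \<in> A" unfolding a0_def using assms(3) by (simp add: some_in_eq)
  have left: "d1 d A a z = dist_to d A z" if "a \<in> A" for a z
    using dist_to_le[OF assms(1) that, of z] dist_to_mem[OF assms(1,2) that]
      Metric_space.commute[OF assms(1), of a z]
    by (simp add: d1_def)
  have right: "d1 d A z a = dist_to d A z" if "a \<in> A" for a z
    using dist_to_le[OF assms(1) that, of z] dist_to_mem[OF assms(1,2) that]
    by (simp add: d1_def)
  show ?thesis
    unfolding quot_d1_def quot_rep_def quot_proj_def a0_def[symmetric]
    using a0 left right dist_to_mem[OF assms(1,2)] by auto
qed


subsection \<open>Diagrams and the Wasserstein distance\<close>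

definition diagrams :: "'a set \<Rightarrow> 'a set \<Rightarrow> 'a multiset set"
  where "diagrams X A = {\<alpha>. set_mset \<alpha> \<subseteq> X - A}"

text \<open>The two existential conditions say that the marginals of \<open>M\<close> are \<open>\<alpha>\<close> and \<open>\<beta>\<close>
  modulo multiples of the basepoint.\<close>

definition matchings ::
  "'a set \<Rightarrow> 'a set \<Rightarrow> 'a multiset \<Rightarrow> 'a multiset \<Rightarrow> ('a option \<times> 'a option) multiset set"
  where "matchings X A \<alpha> \<beta> =
    {M. set_mset M \<subseteq> quot X A \<times> quot X A \<and>
        (\<exists>m. image_mset fst M = image_mset Some \<alpha> + replicate_mset m None) \<and>
        (\<exists>n. image_mset snd M = image_mset Some \<beta> + replicate_mset n None)}"

definition W1 ::
  "'a set \<Rightarrow> ('a \<Rightarrow> 'a \<Rightarrow> real) \<Rightarrow> 'a set \<Rightarrow> 'a multiset \<Rightarrow> 'a multiset \<Rightarrow> real"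
  where "W1 X d A \<alpha> \<beta> = (INF M \<in> matchings X A \<alpha> \<beta>. \<Sum>(u, v)\<in>#M. quot_d1 d A u v)"


subsection \<open>The Grothendieck group and its metric\<close>

text \<open>The Grothendieck group of a free commutative monoid is identified with the free
  abelian group on the same basis; \<open>diagram_class\<close> is the canonical map into it, and the class
  of the point \<open>x\<close> is \<^term>\<open>frag_of x\<close>.\<close>

definition K :: "'a set \<Rightarrow> 'a set \<Rightarrow> ('a \<Rightarrow>\<^sub>0 int) set"
  where "K X A = carrier (free_Abelian_group (X - A))"

definition diagram_class :: "'a multiset \<Rightarrow> ('a \<Rightarrow>\<^sub>0 int)"
  where "diagram_class \<alpha> = (\<Sum>x\<in>#\<alpha>. frag_of x)"

text \<open>The value is the same for all representations of the two arguments as differences of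
  diagrams, see \<open>rho_eq\<close> below.\<close>

definition rho ::
  "'a set \<Rightarrow> ('a \<Rightarrow> 'a \<Rightarrow> real) \<Rightarrow> 'a set \<Rightarrow> ('a \<Rightarrow>\<^sub>0 int) \<Rightarrow> ('a \<Rightarrow>\<^sub>0 int) \<Rightarrow> real"
  where "rho X d A \<kappa> \<mu> =
    (THE r. \<exists>a\<in>diagrams X A. \<exists>b\<in>diagrams X A. \<exists>c\<in>diagrams X A. \<exists>e\<in>diagrams X A.
       \<kappa> = diagram_class a - diagram_class b \<and> \<mu> = diagram_class c - diagram_class e \<and>
       r = W1 X d A (a + e) (c + b))"

lemma lookup_diagram_class: "Poly_Mapping.lookup (diagram_class \<alpha>) x = int (count \<alpha> x)"
  by (induction \<alpha>) (auto simp: diagram_class_def lookup_add)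

lemma keys_diagram_class: "Poly_Mapping.keys (diagram_class \<alpha>) = set_mset \<alpha>"
  by (auto simp: in_keys_iff lookup_diagram_class count_eq_zero_iff)

lemma K_eq_differences:
  "K X A = {diagram_class a - diagram_class b | a b. a \<in> diagrams X A \<and> b \<in> diagrams X A}"
proof (intro equalityI subsetI)
  fix \<kappa> assume "\<kappa> \<in> K X A"
  then have keys: "Poly_Mapping.keys \<kappa> \<subseteq> X - A"
    by (simp add: K_def free_Abelian_group_def)
  have "finite {x. n < nat (Poly_Mapping.lookup \<kappa> x)}" "finite {x. n < nat (- Poly_Mapping.lookup \<kappa> x)}" for n
    by (rule finite_subset[OF _ finite_keys[of \<kappa>]], force simp: in_keys_iff)+
  from this[of 0] have count:
      "count (Abs_multiset (\<lambda>x. nat (Poly_Mapping.lookup \<kappa> x))) x = nat (Poly_Mapping.lookup \<kappa> x)"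
      "count (Abs_multiset (\<lambda>x. nat (- Poly_Mapping.lookup \<kappa> x))) x = nat (- Poly_Mapping.lookup \<kappa> x)" for x
    by (simp_all add: count_Abs_multiset)
  define a where "a = Abs_multiset (\<lambda>x. nat (Poly_Mapping.lookup \<kappa> x))"
  define b where "b = Abs_multiset (\<lambda>x. nat (- Poly_Mapping.lookup \<kappa> x))"
  have "\<kappa> = diagram_class a - diagram_class b"
    by (rule poly_mapping_eqI) (simp add: lookup_minus lookup_diagram_class a_def b_def count)
  moreover have "set_mset a \<subseteq> Poly_Mapping.keys \<kappa>" "set_mset b \<subseteq> Poly_Mapping.keys \<kappa>"
    by (force simp: set_mset_def a_def b_def count in_keys_iff)+
  then have "a \<in> diagrams X A" "b \<in> diagrams X A"
    using keys by (auto simp: diagrams_def)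
  ultimately show "\<kappa> \<in> {diagram_class a - diagram_class b | a b.
      a \<in> diagrams X A \<and> b \<in> diagrams X A}"
    by blast
next
  fix \<kappa> assume "\<kappa> \<in> {diagram_class a - diagram_class b | a b.
      a \<in> diagrams X A \<and> b \<in> diagrams X A}"
  then obtain a b where ab: "a \<in> diagrams X A" "b \<in> diagrams X A"
    and \<kappa>: "\<kappa> = diagram_class a - diagram_class b" by blast
  have "Poly_Mapping.keys \<kappa> \<subseteq> set_mset a \<union> set_mset b"
    unfolding \<kappa> using keys_diff[of "diagram_class a" "diagram_class b"]
    by (simp add: keys_diagram_class)
  also have "\<dots> \<subseteq> X - A" using ab by (auto simp: diagrams_def)
  finally show "\<kappa> \<in> K X A"
    by (simp add: K_def free_Abelian_group_def)
qed

lemma W1_add_mset: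
  assumes met: "Metric_space (quot X A) (quot_d1 d A)"
    and x: "x \<in> X - A" and ab: "\<alpha> \<in> diagrams X A" "\<beta> \<in> diagrams X A"
  shows "W1 X d A (add_mset x \<alpha>) (add_mset x \<beta>) = W1 X d A \<alpha> \<beta>"
proof -
  interpret Metric_space "quot X A" "quot_d1 d A" by (fact met)
  let ?cost = "\<lambda>M. \<Sum>(u, v)\<in>#M. quot_d1 d A u v"
  let ?L = "matchings X A (add_mset x \<alpha>) (add_mset x \<beta>)" and ?R = "matchings X A \<alpha> \<beta>"
  have xq: "Some x \<in> quot X A" using x by (simp add: quot_def)
  have cost_nonneg: "0 \<le> ?cost M" for M
    by (induction M) auto
  have bdd: "bdd_below (?cost ` S)" for S
    using cost_nonneg by (auto intro!: bdd_belowI[of _ 0])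
  have add: "add_mset (Some x, Some x) M \<in> ?L" if "M \<in> ?R" for M
    using that xq by (auto simp: matchings_def)
  have ne: "?R \<noteq> {}"
  proof -
    have "image_mset (\<lambda>y. (Some y, None)) \<alpha> + image_mset (\<lambda>y. (None, Some y)) \<beta> \<in> ?R"
      using ab by (auto simp: matchings_def quot_def diagrams_def multiset.map_comp o_def
          image_mset_const_eq intro!: exI)
    then show ?thesis by blast
  qed
  have remove: "\<exists>M'\<in>?R. ?cost M' \<le> ?cost M" if M: "M \<in> ?L" for M
  proof -
    from M obtain m n where sub: "set_mset M \<subseteq> quot X A \<times> quot X A"
      and m: "image_mset fst M = add_mset (Some x) (image_mset Some \<alpha> + replicate_mset m None)"
      and n: "image_mset snd M = add_mset (Some x) (image_mset Some \<beta> + replicate_mset n None)"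
      by (auto simp: matchings_def)
    from m obtain v M1 where M1: "M = add_mset (Some x, v) M1"
        "image_mset fst M1 = image_mset Some \<alpha> + replicate_mset m None"
      by (metis (no_types, lifting) msed_map_invR prod.collapse)
    show ?thesis
    proof (cases "v = Some x")
      case True
      have "M1 \<in> ?R" using M1 n sub True by (auto simp: matchings_def)
      moreover have "?cost M1 \<le> ?cost M" by (simp add: M1)
      ultimately show ?thesis by blast
    next
      case False
      from n have "add_mset v (image_mset snd M1) =
          add_mset (Some x) (image_mset Some \<beta> + replicate_mset n None)" by (simp add: M1(1))
      then obtain B where B: "image_mset snd M1 = add_mset (Some x) B"
          "image_mset Some \<beta> + replicate_mset n None = add_mset v B"
        using False by (auto simp: add_eq_conv_ex)
      from B(1) obtain u M2 where M2: "M1 = add_mset (u, Some x) M2" "image_mset snd M2 = B"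
        by (metis (no_types, lifting) msed_map_invR prod.collapse)
      have uv: "u \<in> quot X A" "v \<in> quot X A" using sub by (auto simp: M1(1) M2(1))
      have "add_mset (u, v) M2 \<in> ?R"
        unfolding matchings_def
      proof (intro CollectI conjI)
        show "set_mset (add_mset (u, v) M2) \<subseteq> quot X A \<times> quot X A"
          using sub uv by (auto simp: M1(1) M2(1))
        show "\<exists>m. image_mset fst (add_mset (u, v) M2) = image_mset Some \<alpha> + replicate_mset m None"
          using M1(2) M2(1) by (intro exI[of _ m]) simp
        show "\<exists>n. image_mset snd (add_mset (u, v) M2) = image_mset Some \<beta> + replicate_mset n None"
          using B(2) M2(2) by (intro exI[of _ n]) simp
      qed
      moreover have "?cost (add_mset (u, v) M2) \<le> ?cost M"
        using triangle[OF uv(1) xq uv(2)] by (simp add: M1(1) M2(1))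
      ultimately show ?thesis by blast
    qed
  qed
  have neL: "?L \<noteq> {}" using add ne by blast
  show ?thesis
    unfolding W1_def
  proof (rule antisym)
    show "(INF M\<in>?L. ?cost M) \<le> (INF M\<in>?R. ?cost M)"
    proof (rule cINF_mono[OF ne bdd])
      fix M assume "M \<in> ?R"
      then show "\<exists>M'\<in>?L. ?cost M' \<le> ?cost M"
        using add[of M] xq by (intro bexI[of _ "add_mset (Some x, Some x) M"]) simp_all
    qed
    show "(INF M\<in>?R. ?cost M) \<le> (INF M\<in>?L. ?cost M)"
      by (rule cINF_mono[OF neL bdd]) (fact remove)
  qed
qed

lemma W1_translate:
  assumes "Metric_space (quot X A) (quot_d1 d A)"
    and "\<gamma> \<in> diagrams X A" "\<alpha> \<in> diagrams X A" "\<beta> \<in> diagrams X A"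
  shows "W1 X d A (\<alpha> + \<gamma>) (\<beta> + \<gamma>) = W1 X d A \<alpha> \<beta>"
  using assms(2)
proof (induction \<gamma>)
  case (add x \<gamma>)
  then have "x \<in> X - A" "\<gamma> \<in> diagrams X A" "\<alpha> + \<gamma> \<in> diagrams X A" "\<beta> + \<gamma> \<in> diagrams X A"
    using assms(3,4) by (auto simp: diagrams_def)
  then show ?case using W1_add_mset[OF assms(1)] add.IH by simp
qed simp

lemma rho_eq:
  assumes met: "Metric_space (quot X A) (quot_d1 d A)"
    and D: "a \<in> diagrams X A" "b \<in> diagrams X A" "c \<in> diagrams X A" "e \<in> diagrams X A"
  shows "rho X d A (diagram_class a - diagram_class b) (diagram_class c - diagram_class e)
    = W1 X d A (a + e) (c + b)"
proof -
  have cancel: "p + s = r + q"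
    if "diagram_class p - diagram_class q = diagram_class r - diagram_class s" for p q r s :: "'a multiset"
  proof (rule multiset_eqI)
    fix y
    have "int (count p y) - int (count q y) = int (count r y) - int (count s y)"
      using arg_cong[OF that, of "\<lambda>f. Poly_Mapping.lookup f y"]
      by (simp add: lookup_minus lookup_diagram_class)
    then show "count (p + s) y = count (r + q) y" by simp
  qed
  show ?thesis
    unfolding rho_def
  proof (rule the_equality)
    fix r
    assume "\<exists>a'\<in>diagrams X A. \<exists>b'\<in>diagrams X A. \<exists>c'\<in>diagrams X A. \<exists>e'\<in>diagrams X A.
       diagram_class a - diagram_class b = diagram_class a' - diagram_class b' \<and>
       diagram_class c - diagram_class e = diagram_class c' - diagram_class e' \<and>
       r = W1 X d A (a' + e') (c' + b')"
    then obtain a' b' c' e' where D': "a' \<in> diagrams X A" "b' \<in> diagrams X A"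
        "c' \<in> diagrams X A" "e' \<in> diagrams X A"
      and eq: "a + b' = a' + b" "c + e' = c' + e" and r: "r = W1 X d A (a' + e') (c' + b')"
      using cancel by blast
    have "W1 X d A (a + e) (c + b) = W1 X d A ((a + e) + (b' + e')) ((c + b) + (b' + e'))"
      by (rule W1_translate[OF met, symmetric]) (use D D' in \<open>auto simp: diagrams_def\<close>)
    also have "(a + e) + (b' + e') = (a' + e') + (b + e)"
    proof -
      have "(a + e) + (b' + e') = (a + b') + (e + e')" by (simp only: ac_simps)
      also have "\<dots> = (a' + e') + (b + e)" unfolding eq(1) by (simp only: ac_simps)
      finally show ?thesis .
    qed
    also have "(c + b) + (b' + e') = (c' + b') + (b + e)"
    proof -
      have "(c + b) + (b' + e') = (c + e') + (b + b')" by (simp only: ac_simps)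
      also have "\<dots> = (c' + b') + (b + e)" unfolding eq(2) by (simp only: ac_simps)
      finally show ?thesis .
    qed
    also have "W1 X d A ((a' + e') + (b + e)) ((c' + b') + (b + e)) = r"
      unfolding r by (rule W1_translate[OF met]) (use D D' in \<open>auto simp: diagrams_def\<close>)
    finally show "r = W1 X d A (a + e) (c + b)" by simp
  qed (use D in blast)
qed


subsection \<open>The circle, characters and phases\<close>

text \<open>The arguments are meant to lie on the unit circle.\<close>

definition arc_dist :: "complex \<Rightarrow> complex \<Rightarrow> real"
  where "arc_dist z w = (INF k::int. \<bar>Arg z - Arg w + 2 * pi * of_int k\<bar>)"

lemma arc_dist_cis: "arc_dist (cis a) (cis b) = (INF k::int. \<bar>a - b + 2 * pi * of_int k\<bar>)"
proof -
  have arg: "\<exists>k::int. Arg (cis t) = t + 2 * pi * of_int k" for t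
  proof -
    have "cis (Arg (cis t)) = cis t" by (simp add: cis_Arg sgn_div_norm)
    then have "exp (\<i> * of_real (Arg (cis t))) = exp (\<i> * of_real t)" by (simp add: cis_conv_exp)
    then obtain n :: int where "\<i> * of_real (Arg (cis t)) = \<i> * of_real t + (of_int (2 * n) * pi) * \<i>"
      unfolding exp_eq by blast
    then have "Arg (cis t) = t + of_int (2 * n) * pi"
      by (auto simp: complex_eq_iff)
    then show ?thesis by (intro exI[of _ n]) simp
  qed
  obtain k l :: int where k: "Arg (cis a) = a + 2 * pi * of_int k"
    and l: "Arg (cis b) = b + 2 * pi * of_int l" using arg by meson
  have "range (\<lambda>j::int. \<bar>Arg (cis a) - Arg (cis b) + 2 * pi * of_int j\<bar>)
      = (\<lambda>j::int. \<bar>a - b + 2 * pi * of_int j\<bar>) ` range (\<lambda>j. j + (k - l))"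
    unfolding image_image by (rule image_cong[OF refl]) (simp add: k l algebra_simps)
  also have "range (\<lambda>j::int. j + (k - l)) = UNIV"
    by (rule surjI[where f = "\<lambda>j. j - (k - l)"]) simp
  finally show ?thesis by (simp add: arc_dist_def)
qed

text \<open>The points outside \<open>A\<close> are \<open>x 1, \<dots>, x N\<close>, and a point of the torus is given by real
  coordinates \<open>\<theta> 1, \<dots>, \<theta> N\<close>. Both functions below depend on these only modulo \<open>2\<pi>\<close>,
  see \<open>character_cong\<close> and \<open>phase_cong\<close>.\<close>

definition character :: "nat \<Rightarrow> (nat \<Rightarrow> 'a) \<Rightarrow> (nat \<Rightarrow> real) \<Rightarrow> ('a \<Rightarrow>\<^sub>0 int) \<Rightarrow> complex"
  where "character N x \<theta> \<kappa> =
    exp (\<i> * of_real (\<Sum>j=1..N. of_int (Poly_Mapping.lookup \<kappa> (x j)) * \<theta> j))"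

definition phase :: "nat \<Rightarrow> (nat \<Rightarrow> 'a) \<Rightarrow> (nat \<Rightarrow> real) \<Rightarrow> 'a option \<Rightarrow> complex"
  where "phase N x \<theta> u =
    (case u of None \<Rightarrow> 1 | Some y \<Rightarrow> exp (\<i> * of_real (\<theta> (inv_into {1..N} x y))))"

lemma phase_simps:
  "phase N x \<theta> None = 1"
  "inj_on x {1..N} \<Longrightarrow> j \<in> {1..N} \<Longrightarrow> phase N x \<theta> (Some (x j)) = exp (\<i> * of_real (\<theta> j))"
  by (simp_all add: phase_def)

lemma exp_shift: "exp (\<i> * of_real (t + 2 * pi * of_int k)) = exp (\<i> * of_real t)"
proof -
  have "exp (\<i> * of_real (t + 2 * pi * of_int k)) = cis t * cis (2 * pi * of_int k)"
    by (simp only: cis_conv_exp[symmetric] cis_mult)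
  also have "\<dots> = cis t" by simp
  finally show ?thesis by (simp add: cis_conv_exp)
qed

lemma character_cong:
  assumes "\<And>j. j \<in> {1..N} \<Longrightarrow> \<theta>' j = \<theta> j + 2 * pi * of_int (k j)"
  shows "character N x \<theta>' = character N x \<theta>"
proof
  fix \<kappa> :: "'a \<Rightarrow>\<^sub>0 int"
  have "(\<Sum>j=1..N. of_int (Poly_Mapping.lookup \<kappa> (x j)) * \<theta>' j)
    = (\<Sum>j=1..N. of_int (Poly_Mapping.lookup \<kappa> (x j)) * \<theta> j)
      + 2 * pi * of_int (\<Sum>j=1..N. Poly_Mapping.lookup \<kappa> (x j) * k j)"
    by (simp add: assms algebra_simps sum.distrib sum_distrib_left)
  then show "character N x \<theta>' \<kappa> = character N x \<theta> \<kappa>"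
    unfolding character_def by (simp only: exp_shift)
qed

lemma phase_cong:
  assumes "\<And>j. j \<in> {1..N} \<Longrightarrow> \<theta>' j = \<theta> j + 2 * pi * of_int (k j)" "u \<in> insert None (Some ` x ` {1..N})"
  shows "phase N x \<theta>' u = phase N x \<theta> u"
proof (cases u)
  case (Some y)
  then have "inv_into {1..N} x y \<in> {1..N}" using assms(2) by (intro inv_into_into) auto
  then show ?thesis using Some assms(1) by (simp only: phase_def option.case exp_shift)
qed (simp add: phase_def)

end

theory Submission
  imports Defs
begin

text \<open>Sending a point of the quotient to its class in the Grothendieck group, and the basepoint
  to 0, is an injective map which does not increase distances and pulls the character back to the
  phase function; this gives one inequality. Conversely, the phases of the two ends of any
  matching differ by the sum of the phase differences over its pairs, so the subadditivity of the
  arc length bounds the variation of the character by the cost of the matching times the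
  Lipschitz constant of the phase function.\<close>

text \<open>The quotient norm on the reals modulo 2 pi. On real angles, arc length becomes a norm of
  a difference, free of the branch choice in \<open>Arg\<close>.\<close>

definition circle_norm :: "real \<Rightarrow> real"
  where "circle_norm t = (INF k::int. \<bar>t + 2 * pi * of_int k\<bar>)"

lemma arc_dist_cis_eq: "arc_dist (cis a) (cis b) = circle_norm (a - b)"
  by (simp add: arc_dist_cis circle_norm_def)

lemma circle_norm_le: "circle_norm t \<le> \<bar>t + 2 * pi * of_int k\<bar>"
  unfolding circle_norm_def by (rule cINF_lower) (auto intro: bdd_belowI[of _ 0])

lemma circle_norm_greatest: "(\<And>k::int. c \<le> \<bar>t + 2 * pi * of_int k\<bar>) \<Longrightarrow> c \<le> circle_norm t"
  unfolding circle_norm_def by (rule cINF_greatest) auto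

lemma circle_norm_nonneg: "0 \<le> circle_norm t"
  by (rule circle_norm_greatest) simp

lemma circle_norm_zero: "circle_norm 0 = 0"
  using circle_norm_le[of 0 0] circle_norm_nonneg[of 0] by simp

lemma circle_norm_triangle: "circle_norm (s + t) \<le> circle_norm s + circle_norm t"
proof -
  \<comment> \<open>Shifts \<open>k\<close> for \<open>s\<close> and \<open>l\<close> for
    \<open>t\<close> combine to the shift \<open>k + l\<close> for \<open>s + t\<close>. The infimum
    is then taken over \<open>l\<close> first and over \<open>k\<close> second.\<close>
  have "circle_norm (s + t) \<le> \<bar>s + 2 * pi * of_int k\<bar> + \<bar>t + 2 * pi * of_int l\<bar>" for k l :: int
    using circle_norm_le[of "s + t" "k + l"] by (simp add: algebra_simps)
  then have "circle_norm (s + t) - \<bar>s + 2 * pi * of_int k\<bar> \<le> circle_norm t" for k :: int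
    by (intro circle_norm_greatest) (simp add: algebra_simps)
  then have "circle_norm (s + t) - circle_norm t \<le> circle_norm s"
    by (intro circle_norm_greatest) (simp add: algebra_simps)
  then show ?thesis by simp
qed

lemma circle_norm_sum_mset_le: "circle_norm (\<Sum>p\<in>#M. f p) \<le> (\<Sum>p\<in>#M. circle_norm (f p))"
  by (induction M) (auto simp: circle_norm_zero intro: order_trans[OF circle_norm_triangle])

text \<open>A real lift of the phase function, so that phases can be added over multisets. The value
  0 at the basepoint makes extra copies of it in a matching invisible.\<close>

definition angle :: "nat \<Rightarrow> (nat \<Rightarrow> 'a) \<Rightarrow> (nat \<Rightarrow> real) \<Rightarrow> 'a option \<Rightarrow> real"
  where "angle N x \<theta> u = (case u of None \<Rightarrow> 0 | Some y \<Rightarrow> \<theta> (inv_into {1..N} x y))"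

lemma phase_eq_cis: "phase N x \<theta> u = cis (angle N x \<theta> u)"
  by (simp add: phase_def angle_def cis_conv_exp split: option.split)

text \<open>Passes from the sum over indices in \<open>character\<close> to a sum over the points of
  a diagram. Since \<open>x\<close> is injective, adding the point \<open>x i\<close> raises only
  the coefficient of \<open>\<theta> i\<close>, and by one.\<close>

lemma sum_count_eq_sum_mset_angle:
  assumes "inj_on x {1..N}" "set_mset \<alpha> \<subseteq> x ` {1..N}"
  shows "(\<Sum>j=1..N. real (count \<alpha> (x j)) * \<theta> j) = (\<Sum>y\<in>#\<alpha>. angle N x \<theta> (Some y))"
  using assms(2)
proof (induction \<alpha>)
  case (add y \<alpha>)
  then obtain i where i: "i \<in> {1..N}" "y = x i" by auto
  have "(\<Sum>j=1..N. real (count (add_mset y \<alpha>) (x j)) * \<theta> j)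
      = (\<Sum>j=1..N. real (count \<alpha> (x j)) * \<theta> j + (if j = i then \<theta> j else 0))"
    by (rule sum.cong) (use i assms(1) in \<open>auto simp: algebra_simps dest: inj_onD\<close>)
  also have "\<dots> = (\<Sum>j=1..N. real (count \<alpha> (x j)) * \<theta> j) + \<theta> i"
    using i(1) by (simp add: sum.distrib)
  finally show ?case using add i assms(1) by (simp add: angle_def)
qed simp

lemma character_diff_eq_cis:
  assumes "bij_betw x {1..N} (X - A)" "a \<in> diagrams X A" "b \<in> diagrams X A"
  shows "character N x \<theta> (diagram_class a - diagram_class b)
    = cis ((\<Sum>y\<in>#a. angle N x \<theta> (Some y)) - (\<Sum>y\<in>#b. angle N x \<theta> (Some y)))"
proof -
  have inj: "inj_on x {1..N}" and "x ` {1..N} = X - A"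
    using assms(1) by (auto simp: bij_betw_def)
  then have sub: "set_mset a \<subseteq> x ` {1..N}" "set_mset b \<subseteq> x ` {1..N}"
    using assms(2,3) by (auto simp: diagrams_def)
  show ?thesis
    unfolding sum_count_eq_sum_mset_angle[OF inj sub(1), symmetric]
      sum_count_eq_sum_mset_angle[OF inj sub(2), symmetric]
    by (simp add: character_def cis_conv_exp lookup_minus lookup_diagram_class left_diff_distrib
        sum_subtractf)
qed

text \<open>The sum over pairs splits into sums over the two marginals. These are \<alpha> and
  \<beta> up to copies of the basepoint, whose angle is 0.\<close>

lemma sum_mset_angle_matching:
  assumes "M \<in> matchings X A \<alpha> \<beta>"
  shows "(\<Sum>(u, v)\<in>#M. angle N x \<theta> u - angle N x \<theta> v)
    = (\<Sum>y\<in>#\<alpha>. angle N x \<theta> (Some y)) - (\<Sum>y\<in>#\<beta>. angle N x \<theta> (Some y))"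
proof -
  have marginal: "(\<Sum>u\<in>#P. angle N x \<theta> u) = (\<Sum>y\<in>#\<gamma>. angle N x \<theta> (Some y))"
    if "P = image_mset Some \<gamma> + replicate_mset m None" for P \<gamma> m
    unfolding that by (simp add: multiset.map_comp o_def angle_def)
  obtain m n where "image_mset fst M = image_mset Some \<alpha> + replicate_mset m None"
      "image_mset snd M = image_mset Some \<beta> + replicate_mset n None"
    using assms by (auto simp: matchings_def)
  note marginal[OF this(1)] marginal[OF this(2)]
  moreover have "(\<Sum>(u, v)\<in>#M. angle N x \<theta> u - angle N x \<theta> v)
      = (\<Sum>u\<in>#image_mset fst M. angle N x \<theta> u) - (\<Sum>v\<in>#image_mset snd M. angle N x \<theta> v)"
    by (induction M) (auto simp: algebra_simps)
  ultimately show ?thesis by simp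
qed

lemma matchings_nonempty:
  assumes "\<alpha> \<in> diagrams X A" "\<beta> \<in> diagrams X A"
  shows "matchings X A \<alpha> \<beta> \<noteq> {}"
proof -
  \<comment> \<open>Every point of both diagrams is matched with the basepoint.\<close>
  have "image_mset (\<lambda>y. (Some y, None)) \<alpha> + image_mset (\<lambda>y. (None, Some y)) \<beta>
      \<in> matchings X A \<alpha> \<beta>"
    using assms by (auto simp: matchings_def quot_def diagrams_def multiset.map_comp o_def
        image_mset_const_eq intro!: exI)
  then show ?thesis by blast
qed

lemma W1_le_cost:
  assumes "Metric_space (quot X A) (quot_d1 d A)" "M \<in> matchings X A \<alpha> \<beta>"
  shows "W1 X d A \<alpha> \<beta> \<le> (\<Sum>(u, v)\<in>#M. quot_d1 d A u v)"
proof -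
  have "0 \<le> (\<Sum>(u, v)\<in>#M'. quot_d1 d A u v)" for M'
    by (induction M') (auto simp: Metric_space.nonneg[OF assms(1)])
  then show ?thesis
    unfolding W1_def by (intro cINF_lower[OF _ assms(2)]) (auto intro!: bdd_belowI[of _ 0])
qed

text \<open>For a single matching the left side is the norm of a sum of angle differences over
  pairs, so subadditivity and \<open>lip\<close> bound it by \<open>l\<close> times the cost. The
  infimum over matchings then gives \<open>W1\<close>.\<close>

lemma circle_norm_le_W1:
  assumes D: "\<alpha> \<in> diagrams X A" "\<beta> \<in> diagrams X A" and "0 \<le> l"
    and lip: "\<And>u v. u \<in> quot X A \<Longrightarrow> v \<in> quot X A \<Longrightarrow>
      circle_norm (angle N x \<theta> u - angle N x \<theta> v) \<le> l * quot_d1 d A u v"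
  shows "circle_norm ((\<Sum>y\<in>#\<alpha>. angle N x \<theta> (Some y)) - (\<Sum>y\<in>#\<beta>. angle N x \<theta> (Some y)))
    \<le> l * W1 X d A \<alpha> \<beta>" (is "?c \<le> _")
proof -
  have cost: "?c \<le> l * (\<Sum>(u, v)\<in>#M. quot_d1 d A u v)" if M: "M \<in> matchings X A \<alpha> \<beta>" for M
  proof -
    have "?c \<le> (\<Sum>p\<in>#M. circle_norm (case p of (u, v) \<Rightarrow> angle N x \<theta> u - angle N x \<theta> v))"
      unfolding sum_mset_angle_matching[OF M, symmetric] by (rule circle_norm_sum_mset_le)
    also have "\<dots> \<le> (\<Sum>p\<in>#M. l * (case p of (u, v) \<Rightarrow> quot_d1 d A u v))"
      by (rule sum_mset_mono) (use M lip in \<open>auto simp: matchings_def\<close>)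
    finally show ?thesis by (simp add: sum_mset_distrib_left)
  qed
  show ?thesis
  \<comment> \<open>The infimum is reached by dividing by \<open>l\<close>. For \<open>l = 0\<close>
    any one matching already forces the bound 0.\<close>
  proof (cases "l = 0")
    case True
    then show ?thesis using cost matchings_nonempty[OF D] by auto
  next
    case False
    then have "?c / l \<le> W1 X d A \<alpha> \<beta>"
      unfolding W1_def using cost \<open>0 \<le> l\<close>
      by (intro cINF_greatest matchings_nonempty[OF D]) (simp add: field_simps)
    then show ?thesis using False \<open>0 \<le> l\<close> by (simp add: field_simps)
  qed
qed

lemma Lip_le:
  assumes "\<And>\<alpha> \<beta>. \<alpha> \<in> M \<Longrightarrow> \<beta> \<in> M \<Longrightarrow> dN (f \<alpha>) (f \<beta>) \<le> l * dM \<alpha> \<beta>" and "0 \<le> l"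
  shows "Lip M dM dN f \<le> ennreal l"
  unfolding Lip_def
proof (rule SUP_least, clarify)
  fix \<alpha> \<beta> assume "\<alpha> \<in> M" "\<beta> \<in> M"
  then have "ennreal (dN (f \<alpha>) (f \<beta>)) \<le> ennreal l * ennreal (dM \<alpha> \<beta>)"
    using assms by (simp add: ennreal_leI flip: ennreal_mult')
  then show "ennreal (dN (f \<alpha>) (f \<beta>)) / ennreal (dM \<alpha> \<beta>) \<le> ennreal l"
    \<comment> \<open>If the denominator is 0 then so is the numerator, and 0 / 0 = 0 in
      \<open>ennreal\<close>.\<close>
    by (cases "ennreal (dM \<alpha> \<beta>) = 0") (auto intro: divide_le_posI_ennreal simp: zero_less_iff_neq_zero mult.commute)
qed

lemma Lip_bound:
  assumes "Lip M dM dN f = ennreal l" "0 \<le> l" "\<alpha> \<in> M" "\<beta> \<in> M" "\<alpha> \<noteq> \<beta>" "0 < dM \<alpha> \<beta>"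
  shows "dN (f \<alpha>) (f \<beta>) \<le> l * dM \<alpha> \<beta>"
\<comment> \<open>\<open>ennreal\<close> truncates negative values to 0, so a negative
  \<open>dN\<close> is treated apart; there the right side is nonnegative.\<close>
proof (cases "0 \<le> dN (f \<alpha>) (f \<beta>)")
  case True
  have "ennreal (dN (f \<alpha>) (f \<beta>)) / ennreal (dM \<alpha> \<beta>) \<le> ennreal l"
    unfolding assms(1)[symmetric] Lip_def
    by (rule SUP_upper2[of "(\<alpha>, \<beta>)"]) (use assms in auto)
  then have "dN (f \<alpha>) (f \<beta>) / dM \<alpha> \<beta> \<le> l"
    using True assms by (simp add: divide_ennreal)
  then show ?thesis using assms by (simp add: field_simps)
next
  case False
  then show ?thesis using assms by (meson less_imp_le mult_nonneg_nonneg not_le order_trans)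
qed

lemma ennreal_inverse_antimono: "inverse b \<le> inverse a" if "a \<le> b" for a b :: ennreal
  using that by (simp add: less_eq_ennreal.rep_eq inverse_ennreal.rep_eq ereal_inverse_antimono)

text \<open>The pair of images under \<open>h\<close> has the same numerator and a denominator that
  is no larger. Injectivity keeps the images distinct, so that their ratio occurs in the supremum on
  the right.\<close>

lemma Lip_pullback_le:
  assumes "inj_on h M" "h ` M \<subseteq> M'"
    and "\<And>\<alpha> \<beta>. \<alpha> \<in> M \<Longrightarrow> \<beta> \<in> M \<Longrightarrow> dM' (h \<alpha>) (h \<beta>) \<le> dM \<alpha> \<beta>"
    and "\<And>\<alpha>. \<alpha> \<in> M \<Longrightarrow> f' (h \<alpha>) = f \<alpha>"
  shows "Lip M dM dN f \<le> Lip M' dM' dN f'"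
  unfolding Lip_def
proof (rule SUP_least, clarify)
  fix \<alpha> \<beta> assume ab: "\<alpha> \<in> M" "\<beta> \<in> M" "\<alpha> \<noteq> \<beta>"
  then have "h \<alpha> \<noteq> h \<beta>" using assms(1) by (auto dest: inj_onD)
  then show "ennreal (dN (f \<alpha>) (f \<beta>)) / ennreal (dM \<alpha> \<beta>)
      \<le> (SUP (\<alpha>, \<beta>) \<in> {(\<alpha>, \<beta>). \<alpha> \<in> M' \<and> \<beta> \<in> M' \<and> \<alpha> \<noteq> \<beta>}.
          ennreal (dN (f' \<alpha>) (f' \<beta>)) / ennreal (dM' \<alpha> \<beta>))"
    using ab assms(2-)
    by (intro SUP_upper2[of "(h \<alpha>, h \<beta>)"])
      (auto simp: divide_ennreal_def intro!: mult_left_mono ennreal_inverse_antimono ennreal_leI)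
qed

text \<open>Followed by \<open>diagram_class\<close>, this is the map from the quotient into the
  Grothendieck group. The basepoint is identified with 0, hence the empty diagram.\<close>

definition point_diagram :: "'a option \<Rightarrow> 'a multiset"
  where "point_diagram u = (case u of None \<Rightarrow> {#} | Some y \<Rightarrow> {#y#})"

lemma point_diagram_in_diagrams: "u \<in> quot X A \<Longrightarrow> point_diagram u \<in> diagrams X A"
  by (auto simp: point_diagram_def diagrams_def quot_def)

text \<open>The keys of a class recover the support of the diagram, and a diagram with at most one
  point is determined by its support.\<close>

lemma inj_diagram_class_point: "inj (\<lambda>u. diagram_class (point_diagram u))"
proof (rule injI)
  fix u v :: "'a option" assume "diagram_class (point_diagram u) = diagram_class (point_diagram v)"
  then have "set_mset (point_diagram u) = set_mset (point_diagram v)"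
    by (metis keys_diagram_class)
  then show "u = v" by (auto simp: point_diagram_def split: option.splits)
qed

text \<open>Its cost is the quotient distance of \<open>u\<close> and \<open>v\<close>, so it
  witnesses that the map into the Grothendieck group does not increase distances.\<close>

lemma single_pair_matching:
  assumes "u \<in> quot X A" "v \<in> quot X A"
  shows "{#(u, v)#} \<in> matchings X A (point_diagram u) (point_diagram v)"
proof -
  \<comment> \<open>The marginal contains one copy of the basepoint if \<open>w\<close> is
    \<open>None\<close> and no copy otherwise.\<close>
  have "\<exists>m. {#w#} = image_mset Some (point_diagram w) + replicate_mset m None"
    for w :: "'a option"
  proof (cases w)
    case None
    then show ?thesis by (intro exI[of _ 1]) (simp add: point_diagram_def)
  next
    case (Some y)
    then show ?thesis by (intro exI[of _ 0]) (simp add: point_diagram_def)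
  qed
  then show ?thesis using assms by (simp add: matchings_def)
qed

theorem lemma1p1:
  fixes X A :: "'a set" and d :: "'a \<Rightarrow> 'a \<Rightarrow> real"
    and N :: nat and x :: "nat \<Rightarrow> 'a" and \<theta> :: "nat \<Rightarrow> real"
  assumes "Metric_space X d"
    and "A \<subseteq> X" and "A \<noteq> {}"
    and "1 \<le> N" and "bij_betw x {1..N} (X - A)"
    and "Metric_space (quot X A) (quot_d1 d A)"
  shows "Lip (K X A) (rho X d A) arc_dist (character N x \<theta>)
    = Lip (quot X A) (quot_d1 d A) arc_dist (phase N x \<theta>)"
proof (rule antisym)
  note met = assms(6) and bij = assms(5)
  have empty: "{#} \<in> diagrams X A" by (simp add: diagrams_def)
  have [simp]: "diagram_class {#} = 0" by (simp add: diagram_class_def)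
  show "Lip (quot X A) (quot_d1 d A) arc_dist (phase N x \<theta>)
      \<le> Lip (K X A) (rho X d A) arc_dist (character N x \<theta>)"
  proof (rule Lip_pullback_le[where h = "\<lambda>u. diagram_class (point_diagram u)"])
    show "inj_on (\<lambda>u. diagram_class (point_diagram u)) (quot X A)"
      by (rule inj_on_subset[OF inj_diagram_class_point]) simp
    show "(\<lambda>u. diagram_class (point_diagram u)) ` quot X A \<subseteq> K X A"
      by (auto simp: K_def free_Abelian_group_def keys_diagram_class diagrams_def
          dest!: point_diagram_in_diagrams)
  next
    fix u v assume uv: "u \<in> quot X A" "v \<in> quot X A"
    show "rho X d A (diagram_class (point_diagram u)) (diagram_class (point_diagram v))
        \<le> quot_d1 d A u v"
      \<comment> \<open>With empty subtrahends, \<open>rho\<close> is the \<open>W1\<close> distance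
        of the two point diagrams.\<close>
      using rho_eq[OF met point_diagram_in_diagrams[OF uv(1)] empty
          point_diagram_in_diagrams[OF uv(2)] empty] W1_le_cost[OF met single_pair_matching[OF uv]]
      by simp
  next
    fix u assume "u \<in> quot X A"
    then show "character N x \<theta> (diagram_class (point_diagram u)) = phase N x \<theta> u"
      using character_diff_eq_cis[OF bij point_diagram_in_diagrams empty, of u \<theta>]
      by (auto simp: phase_eq_cis point_diagram_def angle_def split: option.split)
  qed
  show "Lip (K X A) (rho X d A) arc_dist (character N x \<theta>)
      \<le> Lip (quot X A) (quot_d1 d A) arc_dist (phase N x \<theta>)"
  \<comment> \<open>Only a finite constant \<open>l\<close> needs an argument; an infinite right
    side is trivial.\<close>
  proof (cases "Lip (quot X A) (quot_d1 d A) arc_dist (phase N x \<theta>)")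
    case (real l)
    have lip: "circle_norm (angle N x \<theta> u - angle N x \<theta> v) \<le> l * quot_d1 d A u v"
      if uv: "u \<in> quot X A" "v \<in> quot X A" for u v
    \<comment> \<open>\<open>Lip\<close> controls only distinct points, while a matching may pair a
      point with itself.\<close>
    proof (cases "u = v")
      case True
      then show ?thesis
        using real Metric_space.nonneg[OF met] by (simp add: circle_norm_zero)
    next
      case False
      then have "0 < quot_d1 d A u v"
        using Metric_space.zero[OF met uv] Metric_space.nonneg[OF met, of u v] by linarith
      then show ?thesis
        using Lip_bound[of _ _ _ "phase N x \<theta>", OF real(2,1) uv False]
        by (simp add: phase_eq_cis arc_dist_cis_eq)
    qed
    have "arc_dist (character N x \<theta> \<kappa>) (character N x \<theta> \<mu>) \<le> l * rho X d A \<kappa> \<mu>"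
      if mem: "\<kappa> \<in> K X A" "\<mu> \<in> K X A" for \<kappa> \<mu>
    proof -
      obtain a b c e where D: "a \<in> diagrams X A" "b \<in> diagrams X A" "c \<in> diagrams X A"
          "e \<in> diagrams X A"
        and eq: "\<kappa> = diagram_class a - diagram_class b" "\<mu> = diagram_class c - diagram_class e"
        using mem unfolding K_eq_differences by blast
      \<comment> \<open>The angle of (a - b) - (c - e) is regrouped as that of (a + e) - (c + b),
        the two diagrams whose \<open>W1\<close> distance defines \<open>rho\<close>.\<close>
      have "a + e \<in> diagrams X A" "c + b \<in> diagrams X A"
        using D by (auto simp: diagrams_def)
      from circle_norm_le_W1[OF this real(1) lip] show ?thesis
        by (simp add: eq rho_eq[OF met D] character_diff_eq_cis[OF bij] D arc_dist_cis_eq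
            algebra_simps)
    qed
    then show ?thesis
      unfolding real(2) using real(1) by (intro Lip_le)
  qed simp
qed

end
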